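(* Let $G=VG_0$ be a primitive affine group, where $V$ is a vector space over $\mathbb{F}_{q_0}$ ($q_0$ a power of the prime $p$), such that $G_0^\infty/Z(G_0^\infty)\cong A_r$ is a non-abelian simple group, $V$ is an absolutely irreducible $\mathbb{F}_{q_0}G_0^\infty$-module, and $V$ cannot be realised over a proper subfield of $\mathbb{F}_{q_0}$. Suppose that $V$ is the fully deleted permutation module. Then (i) if $p\nmid r$, then $\mathrm{orbdiam}(G,V)\geq \frac{r-1}{2}$; (ii) if $p\mid r$, then $\mathrm{orbdiam}(G,V)\geq \frac{r-2}{4}$.
   Context: A primitive affine group is a group $G=VG_0\leq A\Gamma L(V)$, where $V=V_n(q_0)$ is an $n$-dimensional vector space over $\mathbb{F}_{q_0}$ acting on itself by translations, and $G_0\leq \Gamma L(V)$, the stabilizer of $0$, acts irreducibly on $V$. $G_0^\infty$ is the last term of the derived series of $G_0$. For a transitive group $G$ on a finite set $\Omega$, a non-diagonal orbital is a $G$-orbit on $\Omega\times\Omega$ other than the diagonal; the corresponding orbital graph is the undirected graph with vertex set $\Omega$ whose edges are the pairs in the orbital. If $G$ is primitive all of these graphs are connected, and $\mathrm{orbdiam}(G,\Omega)$ is the supremum of their diameters. Fully deleted permutation module: for $A_r$ or $S_r$ acting on $\mathbb{F}_{q_0}^r$ by permuting coordinates, let $W=\{(a_1,\dots,a_r):\sum a_i=0\}$ and $T=\mathrm{Span}(1,\dots,1)$; the fully deleted permutation module is $W/(W\cap T)$. It has dimension $r-1$ if $p\nmid r$ and $r-2$ if $p\mid r$. *)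

theory Defs
  imports
    "HOL-Analysis.Analysis"
    "HOL-Algebra.Algebra"
    "HOL-Algebra.Algebraic_Closure_Type"
    "HOL-Library.Extended_Real"
    "HOL-Library.Set_Algebras"
    "HOL-Library.Function_Algebras"
begin

section \<open>Group-theoretic notions\<close>

text \<open>A set of bijections of the type, regarded as a group under composition.\<close>

definition perm_group :: "('v \<Rightarrow> 'v) set \<Rightarrow> ('v \<Rightarrow> 'v) monoid" where
  "perm_group S = (BijGroup UNIV)\<lparr>carrier := S\<rparr>"

text \<open>The last term of the derived series: the term at which the series becomes stationary
  (it always does if the group is finite).\<close>

definition last_derived :: "('a, 'b) monoid_scheme \<Rightarrow> 'a set" where
  "last_derived H =
     (derived H ^^ (LEAST i. (derived H ^^ Suc i) (carrier H) = (derived H ^^ i) (carrier H)))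
       (carrier H)"

definition group_center :: "('a, 'b) monoid_scheme \<Rightarrow> 'a set" where
  "group_center H = {z \<in> carrier H. \<forall>x \<in> carrier H. z \<otimes>\<^bsub>H\<^esub> x = x \<otimes>\<^bsub>H\<^esub> z}"


section \<open>Primitive affine groups\<close>

definition field_automorphism :: "('k::field \<Rightarrow> 'k) \<Rightarrow> bool" where
  "field_automorphism \<sigma> \<longleftrightarrow>
     bij \<sigma> \<and> (\<forall>a b. \<sigma> (a + b) = \<sigma> a + \<sigma> b) \<and> (\<forall>a b. \<sigma> (a * b) = \<sigma> a * \<sigma> b)"

definition GammaL :: "('k::field ^ 'n \<Rightarrow> 'k ^ 'n) set" where
  "GammaL = {g. bij g \<and> (\<forall>u v. g (u + v) = g u + g v) \<and>
     (\<exists>\<sigma>. field_automorphism \<sigma> \<and> (\<forall>c v. g (c *s v) = \<sigma> c *s g v))}"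

definition translation_group :: "('k::field ^ 'n \<Rightarrow> 'k ^ 'n) set" where
  "translation_group = {\<lambda>x. x + b | b. True}"

definition AGammaL :: "('k::field ^ 'n \<Rightarrow> 'k ^ 'n) set" where
  "AGammaL = {\<lambda>x. g x + b | g b. g \<in> GammaL}"

definition zero_stabilizer :: "('k::field ^ 'n \<Rightarrow> 'k ^ 'n) set \<Rightarrow> ('k ^ 'n \<Rightarrow> 'k ^ 'n) set" where
  "zero_stabilizer G = stabilizer (perm_group G) (\<lambda>g. g) 0"

definition irreducible_on_V :: "('k::field ^ 'n \<Rightarrow> 'k ^ 'n) set \<Rightarrow> bool" where
  "irreducible_on_V S \<longleftrightarrow>
     (\<forall>U. vec.subspace U \<and> (\<forall>g \<in> S. g ` U \<subseteq> U) \<longrightarrow> U = {0} \<or> U = UNIV)"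

text \<open>Irreducibility is over the given field \<open>'k\<close>. This is formally weaker than the
  absence of invariant additive subgroups, which is what primitivity of \<open>G\<close> amounts to; the two
  agree if the last derived term of the stabilizer is absolutely irreducible and not realised over
  a proper subfield.\<close>

definition primitive_affine :: "('k::finite_field ^ 'n \<Rightarrow> 'k ^ 'n) set \<Rightarrow> bool" where
  "primitive_affine G \<longleftrightarrow>
     subgroup G (BijGroup UNIV) \<and> G \<subseteq> AGammaL \<and>
     G = translation_group <#>\<^bsub>BijGroup UNIV\<^esub> zero_stabilizer G \<and>
     irreducible_on_V (zero_stabilizer G)"

abbreviation G0_infty :: "('k::field ^ 'n \<Rightarrow> 'k ^ 'n) set \<Rightarrow> ('k ^ 'n \<Rightarrow> 'k ^ 'n) set" where
  "G0_infty G \<equiv> last_derived (perm_group (zero_stabilizer G))"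


section \<open>Linear groups: absolute irreducibility and fields of definition\<close>

text \<open>\<open>V \<otimes> K\<close> is irreducible, where \<open>K\<close> is the algebraic closure of \<open>'k\<close>;
  \<open>g \<otimes> K\<close> has the same matrix as \<open>g\<close>.\<close>

definition absolutely_irreducible :: "('k::field ^ 'n \<Rightarrow> 'k ^ 'n) set \<Rightarrow> bool" where
  "absolutely_irreducible S \<longleftrightarrow>
     (\<forall>g \<in> S. Vector_Spaces.linear (*s) (*s) g) \<and>
     irreducible_on_V ((\<lambda>g v. map_matrix to_ac (matrix g) *v v) ` S ::
       ('k alg_closure ^ 'n \<Rightarrow> 'k alg_closure ^ 'n) set)"

text \<open>In some basis of \<open>V\<close> (the columns of \<open>P\<close>) all matrices have entries in the subfield.\<close>

definition realised_over :: "('k::field ^ 'n \<Rightarrow> 'k ^ 'n) set \<Rightarrow> 'k set \<Rightarrow> bool" where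
  "realised_over S F \<longleftrightarrow>
     (\<exists>P :: 'k ^ 'n ^ 'n. invertible P \<and>
        (\<forall>g \<in> S. \<forall>i j. (matrix_inv P ** matrix g ** P) $ i $ j \<in> F))"


section \<open>The fully deleted permutation module\<close>

text \<open>Vectors of length \<open>r\<close> are functions on \<open>nat\<close> vanishing outside \<open>{1..r}\<close>, the set on which
  \<open>alt_group r\<close> acts.\<close>

definition fdpm_W :: "nat \<Rightarrow> (nat \<Rightarrow> 'k::field) set" where
  "fdpm_W r = {a. (\<forall>i. i \<notin> {1..r} \<longrightarrow> a i = 0) \<and> (\<Sum>i = 1..r. a i) = 0}"

definition fdpm_T :: "nat \<Rightarrow> (nat \<Rightarrow> 'k::field) set" where
  "fdpm_T r = {\<lambda>i. if i \<in> {1..r} then c else 0 | c. True}"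

text \<open>The quotient space \<open>W / (W \<inter> T)\<close> as a set of cosets. Cosets are added elementwise; for the
  scalar multiple, \<open>W \<inter> T\<close> is added to obtain a full coset also when the scalar is \<open>0\<close>.\<close>

definition fdpm :: "nat \<Rightarrow> (nat \<Rightarrow> 'k::field) set set" where
  "fdpm r = (\<lambda>a. a +o (fdpm_W r \<inter> fdpm_T r)) ` fdpm_W r"

definition fdpm_scale :: "nat \<Rightarrow> 'k::field \<Rightarrow> (nat \<Rightarrow> 'k) set \<Rightarrow> (nat \<Rightarrow> 'k) set" where
  "fdpm_scale r c C = (\<lambda>a i. c * a i) ` C + (fdpm_W r \<inter> fdpm_T r)"

definition fdpm_act :: "(nat \<Rightarrow> nat) \<Rightarrow> (nat \<Rightarrow> 'k::field) set \<Rightarrow> (nat \<Rightarrow> 'k) set" where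
  "fdpm_act \<pi> C = (\<lambda>a i. a (inv_into UNIV \<pi> i)) ` C"

text \<open>\<open>V\<close>, as a module for the group \<open>N\<close>, is isomorphic to the fully deleted permutation
  module, on which \<open>N\<close> acts through an epimorphism onto the alternating group.\<close>

definition is_fdpm :: "nat \<Rightarrow> ('k::field ^ 'n \<Rightarrow> 'k ^ 'n) set \<Rightarrow> bool" where
  "is_fdpm r N \<longleftrightarrow>
     (\<exists>\<phi> f. \<phi> \<in> epi (perm_group N) (alt_group r) \<and>
        bij_betw f (UNIV :: ('k ^ 'n) set) (fdpm r) \<and>
        (\<forall>u v. f (u + v) = f u + f v) \<and>
        (\<forall>c v. f (c *s v) = fdpm_scale r c (f v)) \<and>
        (\<forall>g \<in> N. \<forall>v. f (g v) = fdpm_act (\<phi> g) (f v)))"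


section \<open>Orbital diameter\<close>

definition nondiagonal_orbitals :: "('v \<Rightarrow> 'v) set \<Rightarrow> ('v \<times> 'v) set set" where
  "nondiagonal_orbitals G = orbits (perm_group G) UNIV (\<lambda>g (x, y). (g x, g y)) - {Id}"

text \<open>Distance and diameter in the undirected graph whose edges are the pairs in \<open>E\<close>; the distance
  is \<open>\<infinity>\<close> if there is no path.\<close>

definition graph_dist :: "('v \<times> 'v) set \<Rightarrow> 'v \<Rightarrow> 'v \<Rightarrow> enat" where
  "graph_dist E x y = (INF m \<in> {m. (x, y) \<in> (E \<union> E\<inverse>) ^^ m}. enat m)"

definition graph_diam :: "('v \<times> 'v) set \<Rightarrow> enat" where
  "graph_diam E = (SUP (x, y) \<in> UNIV. graph_dist E x y)"

definition orbdiam :: "('v \<Rightarrow> 'v) set \<Rightarrow> enat" where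
  "orbdiam G = (SUP E \<in> nondiagonal_orbitals G. graph_diam E)"

end

theory Submission
  imports Defs
begin

text \<open>
  Write \<open>q\<close> for the order of the field, \<open>N\<close> for the last derived term of the stabilizer \<open>G\<^sub>0\<close>,
  and represent elements of \<open>V\<close> by sum-zero vectors modulo the constant ones. The bound comes from
  the orbital of \<open>(0, e\<^sub>2 - e\<^sub>1)\<close>: every element of the \<open>G\<^sub>0\<close>-orbit of \<open>e\<^sub>2 - e\<^sub>1\<close> has a
  representative of weight at most 2 (\<open>normalizer_root_weight\<close>), so a point at distance \<open>m\<close> from 0
  has a representative of weight at most \<open>2 m\<close> (\<open>walk_weight\<close>), whereas some cosets contain only
  vectors of weight about \<open>r\<close> (if \<open>p\<close> does not divide \<open>r\<close>) or \<open>r / 2\<close> (if it does).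

  The weight-2 claim needs control of \<open>G\<^sub>0\<close>, of which only the normal subgroup \<open>N\<close> is known to act
  by permutations. An element \<open>g\<close> of \<open>G\<^sub>0\<close> induces an automorphism of the alternating group, and
  it suffices that this automorphism preserves the 3-cycles. They are recognised by the
  commutator set \<open>[V, x] = {x v - v}\<close>, whose cardinality is invariant under conjugation by the
  additive bijection \<open>g\<close>. It is at most
  \<open>q\<^sup>2\<close> for a 3-cycle \<open>x\<close>, but at least \<open>q\<^sup>3\<close> for an element of order 3 with two or more
  cycles of length 3. Now \<open>e\<^sub>2 - e\<^sub>1\<close> lies in \<open>[V, (1 2 3)]\<close> and in \<open>[V, (1 2 4)]\<close>. Its image
  under \<open>g\<close> therefore lies in the commutator sets of two 3-cycles that do not commute. These have
  different supports, so the image is represented by a vector supported on at most two points.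

  The argument compares vectors of weight at most 6 modulo constants, so it needs that no nonzero
  constant vector that sums to 0 has weight at most 6. This fails only if \<open>p\<close> divides \<open>r\<close> and
  \<open>0 < r \<le> 6\<close>; in that range, and for \<open>r \<le> 3\<close>, the bound is at most 1. The excluded range
  contains the case \<open>r = 6\<close>, \<open>p = 3\<close>, in which an exceptional automorphism of the alternating group
  really acts on the module and exchanges the two classes of elements of order 3.
\<close>

section \<open>Sum-zero vectors and their supports\<close>

definition supp :: "(nat \<Rightarrow> 'k::zero) \<Rightarrow> nat set" where
  "supp a = {i. a i \<noteq> 0}"

definition root_vec :: "nat \<Rightarrow> nat \<Rightarrow> nat \<Rightarrow> 'k::ring_1" where
  "root_vec i j = (\<lambda>l. if l = i then 1 else if l = j then - 1 else 0)"

text \<open>The set usually written \<open>[V, x]\<close>. It is a subspace if \<open>x\<close> is linear; cardinality replaces dimension because maps that are merely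
  additive preserve it.\<close>

definition commutator_set :: "('v::minus \<Rightarrow> 'v) \<Rightarrow> 'v set" where
  "commutator_set x = range (\<lambda>v. x v - v)"

lemma fdpm_W_zero: "0 \<in> fdpm_W r"
  by (simp add: fdpm_W_def)

lemma fdpm_W_add: "a \<in> fdpm_W r \<Longrightarrow> b \<in> fdpm_W r \<Longrightarrow> a + b \<in> fdpm_W r"
  by (simp add: fdpm_W_def sum.distrib)

lemma fdpm_W_uminus: "a \<in> fdpm_W r \<Longrightarrow> - a \<in> fdpm_W r"
  by (simp add: fdpm_W_def sum_negf)

lemma fdpm_W_diff: "a \<in> fdpm_W r \<Longrightarrow> b \<in> fdpm_W r \<Longrightarrow> a - b \<in> fdpm_W r"
  by (simp add: fdpm_W_def sum_subtractf)

lemma fdpm_W_permute: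
  assumes "\<pi> permutes {1..r}" "a \<in> fdpm_W r"
  shows "a \<circ> inv' \<pi> \<in> fdpm_W r"
proof -
  have inv: "inv' \<pi> permutes {1..r}"
    using assms(1) by (rule permutes_inv)
  have "(\<Sum>i = 1..r. a (inv' \<pi> i)) = (\<Sum>i = 1..r. a i)"
    using sum.permute[OF inv, of a] by (simp add: o_def)
  moreover have "inv' \<pi> i = i" if "i \<notin> {1..r}" for i
    using inv that by (rule permutes_not_in)
  ultimately show ?thesis
    using assms(2) by (simp add: fdpm_W_def)
qed

lemma root_vec_in_fdpm_W:
  assumes "i \<in> {1..r}" "j \<in> {1..r}" "i \<noteq> j"
  shows "root_vec i j \<in> fdpm_W r"
proof -
  have "(\<Sum>l = 1..r. root_vec i j l :: 'k::field)
      = (\<Sum>l = 1..r. (if l = i then 1 else 0) - (if l = j then 1 else 0))"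
    using assms(3) by (intro sum.cong) (auto simp: root_vec_def)
  also have "\<dots> = 0"
    using assms by (simp add: sum_subtractf)
  finally show ?thesis
    using assms by (auto simp: fdpm_W_def root_vec_def)
qed

lemma root_vec_permute:
  assumes "bij \<pi>"
  shows "root_vec i j \<circ> inv' \<pi> = root_vec (\<pi> i) (\<pi> j)"
proof
  fix l
  have "inv' \<pi> l = i \<longleftrightarrow> l = \<pi> i" for i
    using assms bij_inv_eq_iff by metis
  then show "(root_vec i j \<circ> inv' \<pi>) l = root_vec (\<pi> i) (\<pi> j) l"
    by (simp add: root_vec_def)
qed

lemma supp_fdpm_W: "a \<in> fdpm_W r \<Longrightarrow> supp a \<subseteq> {1..r}"
  by (auto simp: supp_def fdpm_W_def)

lemma supp_zero: "supp 0 = {}"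
  by (simp add: supp_def)

lemma supp_add: "supp (a + b) \<subseteq> supp a \<union> supp (b :: nat \<Rightarrow> 'k::monoid_add)"
  by (auto simp: supp_def)

lemma supp_diff: "supp (a - b) \<subseteq> supp a \<union> supp (b :: nat \<Rightarrow> 'k::group_add)"
  by (auto simp: supp_def)

lemma supp_uminus: "supp (- a) = supp (a :: nat \<Rightarrow> 'k::group_add)"
  by (auto simp: supp_def)

lemma supp_permute_diff:
  fixes a :: "nat \<Rightarrow> 'k::group_add"
  assumes "bij \<pi>"
  shows "supp ((a \<circ> inv' \<pi>) - a) \<subseteq> {i. \<pi> i \<noteq> (i::nat)}"
proof
  fix i assume "i \<in> supp ((a \<circ> inv' \<pi>) - a)"
  then have "inv' \<pi> i \<noteq> i"
    by (auto simp: supp_def)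
  then show "i \<in> {i. \<pi> i \<noteq> i}"
    using assms bij_inv_eq_iff[of \<pi> i i] by auto
qed

text \<open>A sum-zero vector on three points is determined by its values at two of them.\<close>

lemma card_sum_zero_on_three:
  assumes "distinct [a, b, c]" "{a, b, c} \<subseteq> {1..r}"
  shows "card {u \<in> fdpm_W r. supp (u :: nat \<Rightarrow> 'k) \<subseteq> {a, b, c}} \<le> CARD('k::finite_field)\<^sup>2"
    and "finite {u \<in> fdpm_W r. supp (u :: nat \<Rightarrow> 'k) \<subseteq> {a, b, c}}"
proof -
  let ?S = "{u :: nat \<Rightarrow> 'k. u \<in> fdpm_W r \<and> supp u \<subseteq> {a, b, c}}"
  have inj: "inj_on (\<lambda>u. (u a, u b)) ?S"
  proof (rule inj_onI)
    fix u v assume uv: "u \<in> ?S" "v \<in> ?S" "(u a, u b) = (v a, v b)"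
    have "(\<Sum>i = 1..r. w i) = w a + w b + w c" if "w \<in> ?S" for w
    proof -
      have "(\<Sum>i = 1..r. w i) = (\<Sum>i \<in> {a, b, c}. w i)"
        using that assms(2) by (intro sum.mono_neutral_right) (auto simp: supp_def)
      then show ?thesis
        using assms(1) by (simp add: add.assoc)
    qed
    then have "u a + u b + u c = 0" "v a + v b + v c = 0"
      using uv(1,2) by (force simp: fdpm_W_def)+
    then have "u c = v c"
      using uv(3) by (metis Pair_inject add_left_imp_eq)
    moreover have "u i = v i" if "i \<notin> {a, b, c}" for i
    proof -
      have "i \<notin> supp u" "i \<notin> supp v"
        using uv(1,2) that by blast+
      then show ?thesis
        by (simp add: supp_def)
    qed
    ultimately have "u i = v i" for i
      using uv(3) by (cases "i \<in> {a, b, c}") auto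
    then show "u = v" ..
  qed
  show "finite ?S"
    by (rule finite_imageD[OF _ inj]) simp
  have "card ?S \<le> card (UNIV :: ('k \<times> 'k) set)"
    using inj by (intro card_inj_on_le) auto
  then show "card ?S \<le> CARD('k)\<^sup>2"
    by (simp add: power2_eq_square card_prod)
qed


section \<open>Permutations of order three\<close>

lemma three_cycle_apply:
  assumes "distinct [a, b, c]"
  shows "cycle_of_list [a, b, c] i
       = (if i = a then b else if i = b then c else if i = c then a else i)"
  using assms by (auto simp: transpose_def)

text \<open>The second alternative singles out two disjoint cycles of length 3; there may be more.\<close>

lemma cube_eq_id_cases:
  fixes \<pi> :: "nat \<Rightarrow> nat"
  assumes "bij \<pi>" "\<pi> \<circ> \<pi> \<circ> \<pi> = id" "\<pi> \<noteq> id"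
  obtains a b c where "distinct [a, b, c]" "\<pi> = cycle_of_list [a, b, c]"
  | a b c d e f where "distinct [a, b, c, d, e, f]" "\<pi> a = b" "\<pi> b = c" "\<pi> c = a"
      "\<pi> d = e" "\<pi> e = f" "\<pi> f = d"
proof -
  have cube: "\<pi> (\<pi> (\<pi> i)) = i" for i
    using assms(2) by (metis comp_apply id_apply)
  obtain a where a: "\<pi> a \<noteq> a"
    using assms(3) by (metis eq_id_iff)
  define b c where "b = \<pi> a" and "c = \<pi> b"
  have abc: "\<pi> a = b" "\<pi> b = c" "\<pi> c = a"
    using cube by (auto simp: b_def c_def)
  have dist: "distinct [a, b, c]"
    using a abc cube by (metis distinct_length_2_or_more distinct_singleton)
  show thesis
  proof (cases "\<exists>d. d \<notin> {a, b, c} \<and> \<pi> d \<noteq> d")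
    case True
    then obtain d where d: "d \<notin> {a, b, c}" "\<pi> d \<noteq> d" by blast
    define e f where "e = \<pi> d" and "f = \<pi> e"
    have def: "\<pi> d = e" "\<pi> e = f" "\<pi> f = d"
      using cube by (auto simp: e_def f_def)
    have "distinct [d, e, f]"
      using d(2) def cube by (metis distinct_length_2_or_more distinct_singleton)
    moreover have "e \<notin> {a, b, c}" "f \<notin> {a, b, c}"
    proof -
      have "\<pi> i \<in> {a, b, c}" if "i \<in> {a, b, c}" for i
        using that abc by auto
      then show "e \<notin> {a, b, c}" "f \<notin> {a, b, c}"
        using d(1) def by metis+
    qed
    ultimately have "distinct [a, b, c, d, e, f]"
      using dist d(1) by auto
    then show ?thesis
      using abc def by (rule that(2))
  next
    case False
    then have "\<pi> i = i" if "i \<notin> {a, b, c}" for i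
      using that by blast
    then have "\<pi> i = cycle_of_list [a, b, c] i" for i
      unfolding three_cycle_apply[OF dist] using abc by simp
    then show ?thesis
      using that(1)[OF dist] by blast
  qed
qed

lemma three_cycles_same_support_commute:
  assumes "distinct [a, b, c]" "distinct [a', b', c']" "{a, b, c} = {a', b', c'}"
  shows "cycle_of_list [a, b, c] \<circ> cycle_of_list [a', b', c']
       = cycle_of_list [a', b', c'] \<circ> cycle_of_list [a, b, c]"
proof -
  have "a' \<in> {a, b, c}" "b' \<in> {a, b, c}" "c' \<in> {a, b, c}"
    using assms(3) by auto
  then consider "a' = a" "b' = b" "c' = c" | "a' = b" "b' = c" "c' = a"
    | "a' = c" "b' = a" "c' = b" | "a' = a" "b' = c" "c' = b"
    | "a' = b" "b' = a" "c' = c" | "a' = c" "b' = b" "c' = a"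
    using assms(2) by auto
  then show ?thesis
    by cases (use assms(1) in \<open>auto simp: fun_eq_iff three_cycle_apply simp del: cycle_of_list.simps\<close>)
qed

lemma three_cycle_support:
  assumes "distinct [a, b, c]"
  shows "{i. cycle_of_list [a, b, c] i \<noteq> i} = {a, b, c}"
  unfolding three_cycle_apply[OF assms] using assms by auto

section \<open>The module as a quotient of the sum-zero vectors\<close>

text \<open>The map \<open>\<psi>\<close> sends a sum-zero vector to the element of \<open>V\<close> that it represents, so that
  computations in \<open>V\<close> become computations with functions. The structure kept is that of additive
  groups because \<open>N\<close> is going to be conjugated by maps that are only semilinear.\<close>

locale fdpm_quotient =
  fixes r :: nat and N :: "('v::{ab_group_add, finite} \<Rightarrow> 'v) set"
    and \<phi> :: "('v \<Rightarrow> 'v) \<Rightarrow> nat \<Rightarrow> nat" and \<psi> :: "(nat \<Rightarrow> 'k::finite_field) \<Rightarrow> 'v"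
  assumes proj_add: "a \<in> fdpm_W r \<Longrightarrow> b \<in> fdpm_W r \<Longrightarrow> \<psi> (a + b) = \<psi> a + \<psi> b"
    and proj_surj: "\<psi> ` fdpm_W r = UNIV"
    and proj_eq_0_iff: "a \<in> fdpm_W r \<Longrightarrow> \<psi> a = 0 \<longleftrightarrow> a \<in> fdpm_T r"
    and act_proj: "x \<in> N \<Longrightarrow> a \<in> fdpm_W r \<Longrightarrow> x (\<psi> a) = \<psi> (a \<circ> inv' (\<phi> x))"
    and perm_image: "\<phi> ` N = carrier (alt_group r)"
    and perm_comp: "x \<in> N \<Longrightarrow> y \<in> N \<Longrightarrow> \<phi> (x \<circ> y) = \<phi> x \<circ> \<phi> y"
    and comp_closed: "x \<in> N \<Longrightarrow> y \<in> N \<Longrightarrow> x \<circ> y \<in> N"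
    and id_closed: "id \<in> N"
begin

lemma proj_zero: "\<psi> 0 = 0"
  using proj_add[OF fdpm_W_zero fdpm_W_zero] by simp

lemma proj_uminus: "a \<in> fdpm_W r \<Longrightarrow> \<psi> (- a) = - \<psi> a"
  using proj_add[OF fdpm_W_uminus, of a a] proj_zero
  by (simp add: eq_neg_iff_add_eq_0)

lemma proj_diff:
  assumes "a \<in> fdpm_W r" "b \<in> fdpm_W r"
  shows "\<psi> (a - b) = \<psi> a - \<psi> b"
  using proj_add[OF assms(1) fdpm_W_uminus[OF assms(2)]] proj_uminus[OF assms(2)] by simp

lemma proj_eq_iff:
  assumes "a \<in> fdpm_W r" "b \<in> fdpm_W r"
  shows "\<psi> a = \<psi> b \<longleftrightarrow> a - b \<in> fdpm_T r"
  using proj_eq_0_iff[OF fdpm_W_diff[OF assms]] proj_diff[OF assms] by simp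

lemma perm_permutes: "x \<in> N \<Longrightarrow> \<phi> x permutes {1..r}"
  using perm_image alt_group_carrier by blast

lemma perm_id: "\<phi> id = id"
proof -
  have "\<phi> id = \<phi> id \<circ> \<phi> id"
    using perm_comp[OF id_closed id_closed] by simp
  moreover have "inj (\<phi> id)"
    using perm_permutes[OF id_closed] permutes_inj by blast
  ultimately show ?thesis
    by (metis comp_apply eq_id_iff injD)
qed

lemma perm_eq_imp_eq:
  assumes "x \<in> N" "y \<in> N" "\<phi> x = \<phi> y"
  shows "x = y"
proof
  fix v
  obtain a where "a \<in> fdpm_W r" "v = \<psi> a"
    using proj_surj by blast
  then show "x v = y v"
    using act_proj[OF assms(1)] act_proj[OF assms(2)] assms(3) by simp
qed

lemma commutator_set_eq:
  assumes "x \<in> N"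
  shows "commutator_set x = (\<lambda>a. \<psi> ((a \<circ> inv' (\<phi> x)) - a)) ` fdpm_W r"
proof -
  have "x (\<psi> a) - \<psi> a = \<psi> ((a \<circ> inv' (\<phi> x)) - a)" if "a \<in> fdpm_W r" for a
    using act_proj[OF assms that]
      proj_diff[OF fdpm_W_permute[OF perm_permutes[OF assms] that] that] by simp
  moreover have "commutator_set x = (\<lambda>a. x (\<psi> a) - \<psi> a) ` fdpm_W r"
    unfolding commutator_set_def proj_surj[symmetric] by (simp add: image_image)
  ultimately show ?thesis
    by (metis (no_types, lifting) image_cong)
qed

section \<open>Commutator sets of elements of order three\<close>

lemma three_cycle_commutators:
  assumes "x \<in> N" "\<phi> x = cycle_of_list [a, b, c]" "distinct [a, b, c]"
  shows "commutator_set x \<subseteq> \<psi> ` {u \<in> fdpm_W r. supp u \<subseteq> {a, b, c}}"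
proof -
  have perm: "\<phi> x permutes {1..r}"
    using assms(1) by (rule perm_permutes)
  have "(w \<circ> inv' (\<phi> x)) - w \<in> {u \<in> fdpm_W r. supp u \<subseteq> {a, b, c}}" if "w \<in> fdpm_W r" for w
  proof -
    have "supp ((w \<circ> inv' (\<phi> x)) - w) \<subseteq> {a, b, c}"
      using supp_permute_diff[OF permutes_bij[OF perm], of w] three_cycle_support[OF assms(3)]
        assms(2) by simp
    then show ?thesis
      using fdpm_W_diff[OF fdpm_W_permute[OF perm that] that] by simp
  qed
  then show ?thesis
    unfolding commutator_set_eq[OF assms(1)] by blast
qed

lemma moved_in_range:
  assumes "x \<in> N" "\<phi> x i \<noteq> i"
  shows "i \<in> {1..r}"
  using assms perm_permutes permutes_not_in by metis

lemma card_commutators_three_cycle: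
  assumes "x \<in> N" "\<phi> x = cycle_of_list [a, b, c]" "distinct [a, b, c]"
  shows "card (commutator_set x) \<le> CARD('k)\<^sup>2"
proof -
  have sub: "{a, b, c} \<subseteq> {1..r}"
    unfolding three_cycle_support[OF assms(3), symmetric] assms(2)[symmetric]
    using moved_in_range[OF assms(1)] by blast
  let ?S = "{u :: nat \<Rightarrow> 'k. u \<in> fdpm_W r \<and> supp u \<subseteq> {a, b, c}}"
  have "card (commutator_set x) \<le> card (\<psi> ` ?S)"
    using three_cycle_commutators[OF assms] by (intro card_mono) auto
  also have "\<dots> \<le> card ?S"
    using card_sum_zero_on_three(2)[OF assms(3) sub] by (rule card_image_le)
  also have "\<dots> \<le> CARD('k)\<^sup>2"
    using card_sum_zero_on_three(1)[OF assms(3) sub] .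
  finally show ?thesis .
qed

text \<open>For the cycles \<open>(a b c)\<close> and \<open>(d e f)\<close>, the commutators of the sum-zero vectors \<open>w\<close>
  supported on \<open>{a, b, d, e}\<close> are pairwise different: there are \<open>q\<^sup>3\<close> such vectors, and a vector with
  trivial commutator is constant on the cycles of \<open>x\<close>, hence 0 because it vanishes at \<open>c\<close> and \<open>f\<close>.
  The hypothesis on small weights lifts triviality in \<open>V\<close> to triviality of vectors.\<close>

lemma card_commutators_two_three_cycles:
  assumes small: "\<And>a :: nat \<Rightarrow> 'k. a \<in> fdpm_W r \<Longrightarrow> a \<in> fdpm_T r \<Longrightarrow> card (supp a) \<le> 6 \<Longrightarrow> a = 0"
    and x: "x \<in> N" and dist: "distinct [a, b, c, d, e, f]"
    and cyc: "\<phi> x a = b" "\<phi> x b = c" "\<phi> x c = a" "\<phi> x d = e" "\<phi> x e = f" "\<phi> x f = d"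
  shows "CARD('k) ^ 3 \<le> card (commutator_set x)"
proof -
  let ?\<pi> = "\<phi> x"
  have perm: "?\<pi> permutes {1..r}"
    using x by (rule perm_permutes)
  have invs: "inv' ?\<pi> (?\<pi> i) = i" for i
    using permutes_inverses(2)[OF perm] .
  have in_range: "{a, b, d, e} \<subseteq> {1..r}"
    using moved_in_range[OF x, of a] moved_in_range[OF x, of b] moved_in_range[OF x, of d]
      moved_in_range[OF x, of e] dist unfolding cyc by auto
  define w :: "'k \<times> 'k \<times> 'k \<Rightarrow> nat \<Rightarrow> 'k" where
    "w = (\<lambda>(\<alpha>, \<beta>, \<gamma>) i. if i = a then \<alpha> else if i = b then \<beta> else if i = d then \<gamma>
        else if i = e then - (\<alpha> + \<beta> + \<gamma>) else 0)"
  have w_W: "w t \<in> fdpm_W r" for t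
  proof -
    have "(\<Sum>i = 1..r. w t i) = (\<Sum>i \<in> {a, b, d, e}. w t i)"
      using in_range by (intro sum.mono_neutral_right) (auto simp: w_def split: prod.splits)
    also have "\<dots> = 0"
      using dist by (auto simp: w_def split: prod.splits)
    finally show ?thesis
      using in_range by (auto simp: fdpm_W_def w_def split: prod.splits)
  qed
  have "inj (\<lambda>t. \<psi> ((w t \<circ> inv' ?\<pi>) - w t))"
  proof (rule injI)
    fix s t assume eq: "\<psi> ((w s \<circ> inv' ?\<pi>) - w s) = \<psi> ((w t \<circ> inv' ?\<pi>) - w t)"
    define u where "u = w s - w t"
    define D where "D = (u \<circ> inv' ?\<pi>) - u"
    have D_W: "D \<in> fdpm_W r"
      unfolding D_def u_def by (intro fdpm_W_diff fdpm_W_permute perm w_W)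
    have "D = ((w s \<circ> inv' ?\<pi>) - w s) - ((w t \<circ> inv' ?\<pi>) - w t)"
      by (simp add: D_def u_def fun_eq_iff)
    moreover have "((w s \<circ> inv' ?\<pi>) - w s) - ((w t \<circ> inv' ?\<pi>) - w t) \<in> fdpm_T r"
      using eq by (subst (asm) proj_eq_iff) (intro fdpm_W_diff fdpm_W_permute perm w_W)+
    ultimately have D_T: "D \<in> fdpm_T r"
      by simp
    have u_0: "u i = 0" if "i \<notin> {a, b, d, e}" for i
      using that by (auto simp: u_def w_def split: prod.splits)
    have "supp D \<subseteq> {a, b, c, d, e, f}"
    proof
      fix i assume "i \<in> supp D"
      then have "u (inv' ?\<pi> i) \<noteq> 0 \<or> u i \<noteq> 0"
        by (auto simp: supp_def D_def)
      then have "inv' ?\<pi> i \<in> {a, b, d, e} \<or> i \<in> {a, b, d, e}"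
        using u_0 by blast
      moreover have "i = ?\<pi> (inv' ?\<pi> i)"
        using permutes_inverses(1)[OF perm] by simp
      ultimately show "i \<in> {a, b, c, d, e, f}"
        using cyc by (metis insert_iff singletonD)
    qed
    then have "card (supp D) \<le> card {a, b, c, d, e, f}"
      by (intro card_mono) auto
    then have "D = 0"
      using small[OF D_W D_T] dist by simp
    \<comment> \<open>so \<open>u\<close> is constant on the cycles, and it vanishes at \<open>c\<close> and \<open>f\<close>\<close>
    then have "u (inv' ?\<pi> i) = u i" for i
      by (simp add: D_def fun_eq_iff)
    then have step: "u i = u (?\<pi> i)" for i
      by (metis invs)
    have "u c = 0" "u f = 0"
      using dist by (auto intro!: u_0)
    then have "u a = 0" "u b = 0" "u d = 0"
      using step cyc by metis+
    then show "s = t"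
      using dist by (auto simp: u_def w_def split: prod.splits)
  qed
  then have "card (range (\<lambda>t. \<psi> ((w t \<circ> inv' ?\<pi>) - w t))) = CARD('k \<times> 'k \<times> 'k)"
    by (rule card_image)
  moreover have "range (\<lambda>t. \<psi> ((w t \<circ> inv' ?\<pi>) - w t)) \<subseteq> commutator_set x"
    unfolding commutator_set_eq[OF x] using w_W by blast
  then have "card (range (\<lambda>t. \<psi> ((w t \<circ> inv' ?\<pi>) - w t))) \<le> card (commutator_set x)"
    by (intro card_mono) auto
  ultimately show ?thesis
    by (simp add: card_prod power3_eq_cube)
qed

text \<open>Here \<open>y\<close> is the conjugate of \<open>x\<close> by \<open>g\<close>, so \<open>[V, y] = g [V, x]\<close> has at most \<open>q\<^sup>2\<close> elements,
  which excludes every cycle type of order 3 except that of the 3-cycles.\<close>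

lemma conjugate_three_cycle:
  assumes small: "\<And>a :: nat \<Rightarrow> 'k. a \<in> fdpm_W r \<Longrightarrow> a \<in> fdpm_T r \<Longrightarrow> card (supp a) \<le> 6 \<Longrightarrow> a = 0"
    and g: "bij g" "\<And>u v. g (u + v) = g u + g v"
    and x: "x \<in> N" "\<phi> x = cycle_of_list [a, b, c]" "distinct [a, b, c]"
    and y: "y \<in> N" "y \<circ> g = g \<circ> x"
  obtains a' b' c' where "distinct [a', b', c']" "\<phi> y = cycle_of_list [a', b', c']"
    "g ` commutator_set x \<subseteq> \<psi> ` {u \<in> fdpm_W r. supp u \<subseteq> {a', b', c'}}"
proof -
  have g_diff: "g (u - v) = g u - g v" for u v
    using g(2)[of "u - v" v] by simp
  have y_g: "y (g v) = g (x v)" for v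
    using y(2) by (metis comp_apply)
  have surj_g: "g ` UNIV = UNIV"
    using g(1) bij_is_surj by blast
  have comm: "commutator_set y = g ` commutator_set x"
  proof -
    have "commutator_set y = (\<lambda>v. y (g v) - g v) ` UNIV"
      unfolding commutator_set_def by (subst surj_g[symmetric]) (simp add: image_image)
    then show ?thesis
      by (simp add: commutator_set_def image_image y_g g_diff)
  qed
  have "card (commutator_set y) = card (commutator_set x)"
    unfolding comm using g(1) by (intro card_image) (meson bij_is_inj inj_on_subset subset_UNIV)
  also have "\<dots> \<le> CARD('k)\<^sup>2"
    using x by (rule card_commutators_three_cycle)
  also have "\<dots> < CARD('k) ^ 3"
  proof -
    have "1 < CARD('k)"
      using card_mono[of "UNIV :: 'k set" "{0, 1}"] by simp
    then show ?thesis
      by (intro power_strict_increasing) auto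
  qed
  finally have few: "card (commutator_set y) < CARD('k) ^ 3" .
  have cube_x: "\<phi> x \<circ> \<phi> x \<circ> \<phi> x = id"
    unfolding x(2) fun_eq_iff o_apply three_cycle_apply[OF x(3)] using x(3) by auto
  have "x \<circ> x \<circ> x = id"
    using x(1) cube_x
    by (intro perm_eq_imp_eq) (simp_all add: comp_closed id_closed perm_comp perm_id)
  then have "x (x (x v)) = v" for v
    by (metis comp_apply id_apply)
  then have "y (y (y (g v))) = g v" for v
    by (simp add: y_g)
  then have "y (y (y v)) = v" for v
    by (metis g(1) bij_pointE)
  then have "y \<circ> y \<circ> y = id"
    by (simp add: fun_eq_iff)
  then have cube_y: "\<phi> y \<circ> \<phi> y \<circ> \<phi> y = id"
    using y(1) by (metis comp_closed perm_comp perm_id)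
  have "\<phi> y \<noteq> id"
  proof
    assume "\<phi> y = id"
    then have "y = id"
      using perm_eq_imp_eq[OF y(1) id_closed] perm_id by simp
    then have "g (x v) = g v" for v
      using y_g by simp
    then have "x = id"
      using g(1) by (metis bij_is_inj eq_id_iff injD)
    then have "cycle_of_list [a, b, c] a = a"
      using x(2) perm_id by simp
    then show False
      using three_cycle_apply[OF x(3), of a] x(3) by simp
  qed
  with permutes_bij[OF perm_permutes[OF y(1)]] cube_y show thesis
  proof (cases rule: cube_eq_id_cases)
    case (1 a' b' c')
    then show ?thesis
      using that[OF 1] three_cycle_commutators[OF y(1) 1(2) 1(1)] unfolding comm by blast
  next
    case (2 a b c d e f)
    then show ?thesis
      using card_commutators_two_three_cycles[OF small y(1) 2] few by simp
  qed
qed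

text \<open>The 3-cycle fixes \<open>d\<close> and moves \<open>a\<close> to \<open>b\<close>, so the commutator of \<open>e\<^sub>a - e\<^sub>d\<close> is
  \<open>e\<^sub>b - e\<^sub>a\<close>. The auxiliary point \<open>d\<close> makes the vector sum to 0.\<close>

lemma three_cycle_root_commutator:
  assumes "x \<in> N" "\<phi> x = cycle_of_list [a, b, c]" "distinct [a, b, c]" "d \<in> {1..r}" "d \<notin> {a, b, c}"
  shows "\<psi> (root_vec b a) \<in> commutator_set x"
proof -
  have "a \<in> {1..r}"
    using moved_in_range[OF assms(1), of a] three_cycle_apply[OF assms(3), of a] assms(2,3) by simp
  then have W: "root_vec a d \<in> fdpm_W r"
    using assms(4,5) by (intro root_vec_in_fdpm_W) auto
  have "\<phi> x a = b" "\<phi> x d = d"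
    unfolding assms(2) using three_cycle_apply[OF assms(3)] assms(5) by auto
  then have "root_vec a d \<circ> inv' (\<phi> x) = (root_vec b d :: nat \<Rightarrow> 'k)"
    by (simp add: root_vec_permute[OF permutes_bij[OF perm_permutes[OF assms(1)]]])
  moreover have "root_vec b d l - root_vec a d l = (root_vec b a l :: 'k)" for l
    using assms(3,5) by (cases "l = a"; cases "l = b"; cases "l = d") (simp_all add: root_vec_def)
  then have "root_vec b d - root_vec a d = (root_vec b a :: nat \<Rightarrow> 'k)"
    by (simp add: fun_eq_iff)
  ultimately show ?thesis
    unfolding commutator_set_eq[OF assms(1)] using W by (intro image_eqI[of _ _ "root_vec a d"]) auto
qed

section \<open>The orbit of a root vector and the weights reached by walks\<close>

text \<open>The root vector is a commutator of the 3-cycles \<open>(1 2 3)\<close> and \<open>(1 2 4)\<close>. Their conjugates by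
  \<open>g\<close> are 3-cycles whose supports differ, since 3-cycles with equal supports commute and these two
  do not. Representatives of the image on the two supports agree, because their
  difference is a constant vector of weight at most 6; so they live on the intersection.\<close>

lemma normalizer_root_weight:
  assumes small: "\<And>a :: nat \<Rightarrow> 'k. a \<in> fdpm_W r \<Longrightarrow> a \<in> fdpm_T r \<Longrightarrow> card (supp a) \<le> 6 \<Longrightarrow> a = 0"
    and r: "4 \<le> r"
    and g: "bij g" "\<And>u v. g (u + v) = g u + g v"
    and norm: "\<And>x. x \<in> N \<Longrightarrow> \<exists>y \<in> N. y \<circ> g = g \<circ> x"
  shows "\<exists>u \<in> fdpm_W r. card (supp u) \<le> 2 \<and> g (\<psi> (root_vec 2 1)) = \<psi> u"
proof -
  have "cycle_of_list [1, 2, 3] \<in> \<phi> ` N" "cycle_of_list [1, 2, 4] \<in> \<phi> ` N"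
  proof -
    have "cycle_of_list [1, 2, 3] \<in> three_cycles r"
      using r by (intro CollectI exI[of _ "[1, 2, 3]"]) auto
    moreover have "cycle_of_list [1, 2, 4] \<in> three_cycles r"
      using r by (intro CollectI exI[of _ "[1, 2, 4]"]) auto
    ultimately show "cycle_of_list [1, 2, 3] \<in> \<phi> ` N" "cycle_of_list [1, 2, 4] \<in> \<phi> ` N"
      unfolding perm_image using three_cycles_incl by blast+
  qed
  then obtain x y where x: "x \<in> N" "\<phi> x = cycle_of_list [1, 2, 3]"
    and y: "y \<in> N" "\<phi> y = cycle_of_list [1, 2, 4]"
    by (metis imageE)
  have dist: "distinct [1, 2, 3 :: nat]" "distinct [1, 2, 4 :: nat]"
    by simp_all
  obtain x' where x': "x' \<in> N" "x' \<circ> g = g \<circ> x"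
    using norm x(1) by blast
  obtain y' where y': "y' \<in> N" "y' \<circ> g = g \<circ> y"
    using norm y(1) by blast
  obtain a b c where abc: "distinct [a, b, c]" "\<phi> x' = cycle_of_list [a, b, c]"
    "g ` commutator_set x \<subseteq> \<psi> ` {u \<in> fdpm_W r. supp u \<subseteq> {a, b, c}}"
    using conjugate_three_cycle[OF small g x dist(1) x'] by blast
  obtain d e f where def: "distinct [d, e, f]" "\<phi> y' = cycle_of_list [d, e, f]"
    "g ` commutator_set y \<subseteq> \<psi> ` {u \<in> fdpm_W r. supp u \<subseteq> {d, e, f}}"
    using conjugate_three_cycle[OF small g y dist(2) y'] by blast
  have "\<psi> (root_vec 2 1) \<in> commutator_set x" "\<psi> (root_vec 2 1) \<in> commutator_set y"
    using three_cycle_root_commutator[OF x dist(1), of 4]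
      three_cycle_root_commutator[OF y dist(2), of 3] r by auto
  then obtain u v where u: "u \<in> fdpm_W r" "supp u \<subseteq> {a, b, c}" "g (\<psi> (root_vec 2 1)) = \<psi> u"
    and v: "v \<in> fdpm_W r" "supp v \<subseteq> {d, e, f}" "g (\<psi> (root_vec 2 1)) = \<psi> v"
    using abc(3) def(3) by blast
  have "u - v \<in> fdpm_T r"
    using proj_eq_iff[OF u(1) v(1)] u(3) v(3) by simp
  moreover have "card (supp (u - v)) \<le> 6"
  proof -
    have "supp (u - v) \<subseteq> set [a, b, c, d, e, f]"
      using supp_diff[of u v] u(2) v(2) by auto
    then have "card (supp (u - v)) \<le> card (set [a, b, c, d, e, f])"
      by (intro card_mono) auto
    also have "\<dots> \<le> length [a, b, c, d, e, f]"
      by (rule card_length)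
    finally show ?thesis
      by simp
  qed
  ultimately have "u - v = 0"
    using small fdpm_W_diff[OF u(1) v(1)] by blast
  then have supp_u: "supp u \<subseteq> {a, b, c} \<inter> {d, e, f}"
    using u(2) v(2) by simp
  have "{a, b, c} \<noteq> {d, e, f}"
  proof
    assume "{a, b, c} = {d, e, f}"
    then have "\<phi> x' \<circ> \<phi> y' = \<phi> y' \<circ> \<phi> x'"
      unfolding abc(2) def(2) by (rule three_cycles_same_support_commute[OF abc(1) def(1)])
    then have "x' \<circ> y' = y' \<circ> x'"
      using x'(1) y'(1) by (intro perm_eq_imp_eq) (simp_all add: comp_closed perm_comp)
    then have "x' \<circ> y' \<circ> g = y' \<circ> x' \<circ> g"
      by simp
    then have "g \<circ> (x \<circ> y) = g \<circ> (y \<circ> x)"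
      using x'(2) y'(2) by (metis comp_assoc)
    then have "x \<circ> y = y \<circ> x"
      using g(1) by (metis bij_is_inj fun.inj_map inj_eq)
    then have "(\<phi> x \<circ> \<phi> y) 1 = (\<phi> y \<circ> \<phi> x) 1"
      using x(1) y(1) by (metis perm_comp)
    then show False
      unfolding x(2) y(2) o_apply three_cycle_apply[OF dist(1)] three_cycle_apply[OF dist(2)]
      by simp
  qed
  then have "{a, b, c} \<inter> {d, e, f} \<subset> {a, b, c}"
    using abc(1) def(1) card_seteq[of "{d, e, f}" "{a, b, c}"] by auto
  then have "card ({a, b, c} \<inter> {d, e, f}) < card {a, b, c}"
    by (intro psubset_card_mono) auto
  moreover have "card (supp u) \<le> card ({a, b, c} \<inter> {d, e, f})"
    using supp_u by (intro card_mono) auto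
  ultimately have "card (supp u) \<le> 2"
    using abc(1) by simp
  then show ?thesis
    using u by blast
qed

lemma walk_weight:
  assumes edge: "\<And>v w. (v, w) \<in> E \<Longrightarrow> \<exists>u \<in> fdpm_W r. card (supp u) \<le> 2 \<and> w - v = \<psi> u"
    and walk: "(0, z) \<in> (E \<union> E\<inverse>) ^^ m"
  shows "\<exists>u \<in> fdpm_W r. card (supp u) \<le> 2 * m \<and> z = \<psi> u"
  using walk
proof (induction m arbitrary: z)
  case 0
  then have "card (supp (0 :: nat \<Rightarrow> 'k)) \<le> 2 * 0 \<and> z = \<psi> 0"
    using proj_zero by (simp add: supp_zero)
  then show ?case
    using fdpm_W_zero by blast
next
  case (Suc m)
  then obtain y where y: "(0, y) \<in> (E \<union> E\<inverse>) ^^ m" "(y, z) \<in> E \<union> E\<inverse>"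
    by auto
  obtain u where u: "u \<in> fdpm_W r" "card (supp u) \<le> 2 * m" "y = \<psi> u"
    using Suc.IH y(1) by blast
  have "\<exists>u \<in> fdpm_W r. card (supp u) \<le> 2 \<and> z - y = \<psi> u"
  proof (cases "(y, z) \<in> E")
    case False
    then obtain u where "u \<in> fdpm_W r" "card (supp u) \<le> 2" "y - z = \<psi> u"
      using edge y(2) by blast
    then show ?thesis
      by (intro bexI[OF _ fdpm_W_uminus]) (auto simp: supp_uminus proj_uminus simp flip: minus_diff_eq[of y z])
  qed (rule edge)
  then obtain v where v: "v \<in> fdpm_W r" "card (supp v) \<le> 2" "z - y = \<psi> v"
    by blast
  have "card (supp (u + v)) \<le> card (supp u \<union> supp v)"
    using supp_fdpm_W[OF u(1)] supp_fdpm_W[OF v(1)] finite_subset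
    by (intro card_mono supp_add) blast
  also have "\<dots> \<le> card (supp u) + card (supp v)"
    by (rule card_Un_le)
  finally have "card (supp (u + v)) \<le> 2 * Suc m"
    using u(2) v(2) by simp
  moreover have "z = \<psi> (u + v)"
    using proj_add[OF u(1) v(1)] u(3) v(3) by (metis add_diff_cancel_left' diff_add_cancel add.commute)
  ultimately show ?case
    using fdpm_W_add[OF u(1) v(1)] by blast
qed

end


section \<open>Cosets of large weight\<close>

lemma card_supp_fdpm_T:
  assumes "a \<in> fdpm_T r" "a \<noteq> 0"
  shows "card (supp a) = r"
proof -
  obtain c where a: "a = (\<lambda>i. if i \<in> {1..r} then c else 0)"
    using assms(1) by (auto simp: fdpm_T_def)
  moreover have "c \<noteq> 0"
    using assms(2) a by (auto simp: fun_eq_iff)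
  ultimately have "supp a = {1..r}"
    by (auto simp: supp_def)
  then show ?thesis
    by simp
qed

lemma fdpm_W_inter_T_trivial:
  fixes a :: "nat \<Rightarrow> 'k::field"
  assumes "\<not> CHAR('k) dvd r" "a \<in> fdpm_W r" "a \<in> fdpm_T r"
  shows "a = 0"
proof -
  obtain c where a: "a = (\<lambda>i. if i \<in> {1..r} then c else 0)"
    using assms(3) by (auto simp: fdpm_T_def)
  have "(\<Sum>i = 1..r. a i) = of_nat r * c"
    by (simp add: a)
  then have "c = 0"
    using assms(1,2) by (simp add: fdpm_W_def of_nat_eq_0_iff_char_dvd)
  then show ?thesis
    by (simp add: a fun_eq_iff)
qed

text \<open>Its coset is far from 0: adding a constant cannot clear both the first \<open>2 h\<close> entries and
  the remaining ones.\<close>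

definition step_vec :: "nat \<Rightarrow> nat \<Rightarrow> 'k::ring_1" where
  "step_vec h = (\<lambda>i. if i \<in> {1..h} then 1 else if i \<in> {h + 1..2 * h} then - 1 else 0)"

lemma supp_step_vec: "supp (step_vec h :: nat \<Rightarrow> 'k::ring_1) = {1..2 * h}"
  by (auto simp: supp_def step_vec_def)

lemma step_vec_in_fdpm_W:
  assumes "2 * h \<le> r"
  shows "(step_vec h :: nat \<Rightarrow> 'k::field) \<in> fdpm_W r"
proof -
  have "{1..r} = {1..h} \<union> {h + 1..2 * h} \<union> {2 * h + 1..r}"
    using assms by auto
  then have "(\<Sum>i = 1..r. step_vec h i :: 'k)
      = (\<Sum>i = 1..h. step_vec h i) + (\<Sum>i = h + 1..2 * h. step_vec h i) + (\<Sum>i = 2 * h + 1..r. step_vec h i)"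
    by (simp only:) (subst sum.union_disjoint; auto)+
  also have "\<dots> = (\<Sum>i = 1..h. 1) + (\<Sum>i = h + 1..2 * h. - 1) + (\<Sum>i = 2 * h + 1..r. 0)"
    by (intro arg_cong2[of _ _ _ _ "(+)"] sum.cong) (auto simp: step_vec_def)
  also have "\<dots> = 0"
    by simp
  finally show ?thesis
    using assms by (auto simp: fdpm_W_def step_vec_def)
qed

text \<open>Adding a nonzero constant makes all entries beyond \<open>2 h\<close> nonzero.\<close>

lemma step_vec_coset_weight:
  fixes u :: "nat \<Rightarrow> 'k::field"
  assumes "2 * h \<le> r" "u \<in> fdpm_W r" "u - step_vec h \<in> fdpm_T r"
  shows "2 * h \<le> card (supp u) \<or> r - 2 * h \<le> card (supp u)"
proof -
  obtain c where c: "u - step_vec h = (\<lambda>i. if i \<in> {1..r} then c else 0)"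
    using assms(3) by (auto simp: fdpm_T_def)
  have u: "u i = step_vec h i + (if i \<in> {1..r} then c else 0)" for i
    using fun_cong[OF c, of i] by (simp add: algebra_simps)
  have fin: "finite (supp u)"
    using supp_fdpm_W[OF assms(2)] finite_subset by blast
  show ?thesis
  proof (cases "c = 0")
    case True
    then have "supp u = supp (step_vec h :: nat \<Rightarrow> 'k)"
      using u by (auto simp: supp_def)
    then show ?thesis
      by (simp add: supp_step_vec)
  next
    case False
    then have "{2 * h + 1..r} \<subseteq> supp u"
      by (auto simp: supp_def u step_vec_def)
    then have "card {2 * h + 1..r} \<le> card (supp u)"
      using fin by (rule card_mono[rotated])
    then show ?thesis
      by simp
  qed
qed

section \<open>Primitive affine groups\<close>

lemma Bij_UNIV: "Bij UNIV = {f. bij f}"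
  by (simp add: Bij_def)

lemma perm_group_simps:
  "carrier (perm_group S) = S"
  "bij g \<Longrightarrow> bij h \<Longrightarrow> g \<otimes>\<^bsub>perm_group S\<^esub> h = g \<circ> h"
  "bij g \<Longrightarrow> bij h \<Longrightarrow> g \<otimes>\<^bsub>BijGroup UNIV\<^esub> h = g \<circ> h"
  "\<one>\<^bsub>BijGroup UNIV\<^esub> = id"
  "carrier (BijGroup UNIV) = {f. bij f}"
  by (simp_all add: perm_group_def BijGroup_def Bij_UNIV compose_def fun_eq_iff)

lemma zero_stabilizer_eq: "zero_stabilizer G = {g \<in> G. g 0 = 0}"
  by (simp add: zero_stabilizer_def stabilizer_def perm_group_simps)

lemma zero_stabilizer_subgroup:
  assumes "subgroup G (BijGroup UNIV)"
  shows "subgroup (zero_stabilizer G) (BijGroup UNIV)"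
proof -
  interpret G: subgroup G "BijGroup UNIV" by fact
  have bij: "bij g" if "g \<in> G" for g
    using G.mem_carrier[OF that] by (simp add: perm_group_simps)
  show ?thesis
  proof
    show "zero_stabilizer G \<subseteq> carrier (BijGroup UNIV)"
      using G.subset by (auto simp: zero_stabilizer_eq)
  next
    fix g h assume gh: "g \<in> zero_stabilizer G" "h \<in> zero_stabilizer G"
    then have "g \<in> G" "h \<in> G"
      by (simp_all add: zero_stabilizer_eq)
    then have "g \<otimes>\<^bsub>BijGroup UNIV\<^esub> h \<in> G" "g \<otimes>\<^bsub>BijGroup UNIV\<^esub> h = g \<circ> h"
      by (rule G.m_closed, simp add: bij perm_group_simps(3))
    then show "g \<otimes>\<^bsub>BijGroup UNIV\<^esub> h \<in> zero_stabilizer G"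
      using gh by (simp add: zero_stabilizer_eq)
  next
    show "\<one>\<^bsub>BijGroup UNIV\<^esub> \<in> zero_stabilizer G"
      using G.one_closed by (simp add: zero_stabilizer_eq perm_group_simps)
  next
    fix g assume g: "g \<in> zero_stabilizer G"
    then have "inv\<^bsub>BijGroup UNIV\<^esub> g = inv' g"
      using inv_BijGroup[of g UNIV] bij by (simp add: zero_stabilizer_eq Bij_UNIV fun_eq_iff)
    moreover have "inv' g 0 = 0"
      using g bij[of g] bij_inv_eq_iff[of g 0 0] by (simp add: zero_stabilizer_eq)
    ultimately show "inv\<^bsub>BijGroup UNIV\<^esub> g \<in> zero_stabilizer G"
      using G.m_inv_closed[of g] g by (simp add: zero_stabilizer_eq)
  qed
qed

lemma (in group) last_derived_normal: "last_derived G \<lhd> G"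
proof -
  have "(derived G ^^ i) (carrier G) \<lhd> G" for i
  proof (induction i)
    case 0
    then show ?case
      by (simp add: normal_self)
  next
    case (Suc i)
    then show ?case
      by (simp add: derived_is_normal)
  qed
  then show ?thesis
    by (simp add: last_derived_def)
qed

text \<open>Normality of the last derived term in the stabilizer, in a form that avoids inverses: \<open>y\<close> is the
  conjugate of \<open>x\<close> by \<open>g\<close>.\<close>

lemma G0_infty_properties:
  assumes "subgroup G (BijGroup UNIV)"
  shows "subgroup (G0_infty G) (BijGroup UNIV)"
    and "g \<in> zero_stabilizer G \<Longrightarrow> x \<in> G0_infty G \<Longrightarrow> \<exists>y \<in> G0_infty G. y \<circ> g = g \<circ> x"
proof -
  let ?S = "zero_stabilizer G"
  let ?N = "G0_infty G"
  have S: "subgroup ?S (BijGroup UNIV)"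
    using assms by (rule zero_stabilizer_subgroup)
  have grp: "group (perm_group ?S)"
    unfolding perm_group_def using group.subgroup_imp_group[OF group_BijGroup S] .
  interpret S: group "perm_group ?S" by (rule grp)
  interpret N: normal ?N "perm_group ?S" by (rule S.last_derived_normal)
  show N: "subgroup ?N (BijGroup UNIV)"
    using group.incl_subgroup[OF group_BijGroup S] N.subgroup_axioms by (simp add: perm_group_def)
  assume g: "g \<in> ?S" and x: "x \<in> ?N"
  let ?y = "g \<otimes>\<^bsub>perm_group ?S\<^esub> x \<otimes>\<^bsub>perm_group ?S\<^esub> inv\<^bsub>perm_group ?S\<^esub> g"
  have g': "g \<in> carrier (perm_group ?S)" and x': "x \<in> carrier (perm_group ?S)"
    using g x N.subset by (auto simp: perm_group_simps)
  have y: "?y \<in> ?N"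
    using N.inv_op_closed2[OF g' x] .
  then have y': "?y \<in> carrier (perm_group ?S)"
    using N.subset by auto
  have "?y \<otimes>\<^bsub>perm_group ?S\<^esub> g = g \<otimes>\<^bsub>perm_group ?S\<^esub> x"
    using g' x' by (simp add: S.m_assoc)
  moreover have "bij h" if "h \<in> carrier (perm_group ?S)" for h
    using that subgroup.subset[OF S] by (auto simp: perm_group_simps)
  ultimately have "?y \<circ> g = g \<circ> x"
    using g' x' y' by (metis perm_group_simps(2))
  then show "\<exists>y \<in> ?N. y \<circ> g = g \<circ> x"
    using y by blast
qed

lemma primitive_affine_elements:
  assumes "primitive_affine G"
  shows "g \<in> zero_stabilizer G \<Longrightarrow> bij g"
    and "g \<in> zero_stabilizer G \<Longrightarrow> g (u + v) = g u + g v"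
    and "h \<in> G \<Longrightarrow> \<exists>g \<in> zero_stabilizer G. \<forall>v. h v = g v + h 0"
proof -
  have sub: "subgroup G (BijGroup UNIV)" and aff: "G \<subseteq> AGammaL"
    and split: "G = translation_group <#>\<^bsub>BijGroup UNIV\<^esub> zero_stabilizer G"
    using assms by (auto simp: primitive_affine_def)
  have bij: "bij g" if "g \<in> G" for g
    using subgroup.mem_carrier[OF sub that] by (simp add: perm_group_simps)
  show "bij g" if "g \<in> zero_stabilizer G" for g
    using that bij by (simp add: zero_stabilizer_eq)
  show "g (u + v) = g u + g v" if "g \<in> zero_stabilizer G" for g u v
  proof -
    have "g \<in> AGammaL" "g 0 = 0"
      using that aff by (auto simp: zero_stabilizer_eq)
    then obtain l b where l: "g = (\<lambda>x. l x + b)" "l \<in> GammaL"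
      by (auto simp: AGammaL_def)
    have add: "l (u + v) = l u + l v" for u v
      using l(2) by (simp add: GammaL_def)
    have "l 0 = 0"
      using add[of 0 0] by simp
    then have "b = 0"
      using l(1) \<open>g 0 = 0\<close> by simp
    then show ?thesis
      using l(1) add by simp
  qed
  show "\<exists>g \<in> zero_stabilizer G. \<forall>v. h v = g v + h 0" if "h \<in> G" for h
  proof -
    obtain t g where tg: "t \<in> translation_group" "g \<in> zero_stabilizer G"
      "h = t \<otimes>\<^bsub>BijGroup UNIV\<^esub> g"
    proof -
      have "h \<in> translation_group <#>\<^bsub>BijGroup UNIV\<^esub> zero_stabilizer G"
        using \<open>h \<in> G\<close> split by blast
      then show ?thesis
        using that by (auto simp: set_mult_def)
    qed
    obtain b where b: "t = (\<lambda>x. x + b)"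
      using tg(1) by (auto simp: translation_group_def)
    have "bij t"
      unfolding b by (rule bij_plus_right)
    then have "h = t \<circ> g"
      using tg(2,3) bij by (simp add: perm_group_simps zero_stabilizer_eq)
    then have "h v = g v + h 0" for v
      using b tg(2) by (simp add: zero_stabilizer_eq)
    then show ?thesis
      using tg(2) by blast
  qed
qed

text \<open>The map \<open>\<psi>\<close> is the quotient map followed by the inverse of the module isomorphism.\<close>

lemma is_fdpm_imp_quotient:
  fixes N :: "('k::finite_field ^ 'n \<Rightarrow> 'k ^ 'n) set"
  assumes fdpm: "is_fdpm r N" and N: "subgroup N (BijGroup UNIV)"
  obtains \<phi> and \<psi> :: "(nat \<Rightarrow> 'k) \<Rightarrow> 'k ^ 'n" where "fdpm_quotient r N \<phi> \<psi>"
proof -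
  obtain \<phi> f where \<phi>: "\<phi> \<in> epi (perm_group N) (alt_group r)"
    and f: "bij_betw f (UNIV :: ('k ^ 'n) set) (fdpm r :: (nat \<Rightarrow> 'k) set set)"
    and f_add: "\<And>u v. f (u + v) = f u + f v"
    and f_act: "\<And>g v. g \<in> N \<Longrightarrow> f (g v) = fdpm_act (\<phi> g) (f v)"
    using fdpm unfolding is_fdpm_def by blast
  define K :: "(nat \<Rightarrow> 'k) set" where "K = fdpm_W r \<inter> fdpm_T r"
  define \<psi> where "\<psi> a = inv_into UNIV f (a +o K)" for a
  have f_\<psi>: "f (\<psi> a) = a +o K" if "a \<in> fdpm_W r" for a
    unfolding \<psi>_def using that bij_betw_imp_surj_on[OF f]
    by (intro f_inv_into_f) (auto simp: fdpm_def K_def)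
  have \<psi>_eq: "\<psi> a = v" if "f v = a +o K" for a v
    unfolding \<psi>_def that[symmetric] using bij_betw_imp_inj_on[OF f] by simp
  have T_add: "a + b \<in> fdpm_T r" if "a \<in> fdpm_T r" "b \<in> fdpm_T r" for a b :: "nat \<Rightarrow> 'k"
    using that by (force simp: fdpm_T_def fun_eq_iff)
  have K_0: "0 \<in> K"
    by (auto simp: K_def fdpm_W_zero fdpm_T_def fun_eq_iff)
  have K_K: "K + K = K"
  proof
    show "K + K \<subseteq> K"
      using T_add fdpm_W_add unfolding K_def set_plus_def by blast
    show "K \<subseteq> K + K"
      using K_0 by (rule set_zero_plus2)
  qed
  have bij: "bij g" if "g \<in> N" for g
    using subgroup.mem_carrier[OF N that] by (simp add: perm_group_simps)
  have comp: "g \<otimes>\<^bsub>perm_group N\<^esub> h = g \<circ> h" "g \<circ> h \<in> N" if "g \<in> N" "h \<in> N" for g h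
    using that bij subgroup.m_closed[OF N that] by (simp_all add: perm_group_simps)
  have perm: "\<phi> g permutes {1..r}" if "g \<in> N" for g
    using \<phi> that alt_group_carrier by (auto simp: epi_def perm_group_simps)
  have add: "\<psi> (a + b) = \<psi> a + \<psi> b" if "a \<in> fdpm_W r" "b \<in> fdpm_W r" for a b
    using that by (intro \<psi>_eq) (simp add: f_add f_\<psi> set_plus_rearrange K_K)
  have zero: "\<psi> 0 = 0"
    using add[OF fdpm_W_zero fdpm_W_zero] by simp
  have "fdpm_quotient r N \<phi> \<psi>"
  proof
    show "\<psi> (a + b) = \<psi> a + \<psi> b" if "a \<in> fdpm_W r" "b \<in> fdpm_W r" for a b
      using that by (rule add)
  next
    have "\<exists>a \<in> fdpm_W r. \<psi> a = v" for v
    proof -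
      have "f v \<in> fdpm r"
        using bij_betw_imp_surj_on[OF f] by blast
      then show ?thesis
        using \<psi>_eq by (auto simp: fdpm_def K_def)
    qed
    then show "\<psi> ` fdpm_W r = UNIV"
      by (metis UNIV_eq_I imageI)
  next
    fix a :: "nat \<Rightarrow> 'k" assume a: "a \<in> fdpm_W r"
    have "\<psi> a = 0 \<longleftrightarrow> f (\<psi> a) = f (\<psi> 0)"
      using bij_betw_imp_inj_on[OF f] by (simp add: inj_eq zero)
    also have "\<dots> \<longleftrightarrow> a +o K = K"
      by (simp add: f_\<psi> a fdpm_W_zero)
    also have "\<dots> \<longleftrightarrow> a \<in> K"
    proof
      assume "a +o K = K"
      moreover have "a + 0 \<in> a +o K"
        using K_0 by (rule set_plus_intro2)
      ultimately show "a \<in> K"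
        by simp
    next
      assume "a \<in> K"
      have "- k \<in> fdpm_T r" if "k \<in> fdpm_T r" for k :: "nat \<Rightarrow> 'k"
        using that by (force simp: fdpm_T_def fun_eq_iff)
      then have "- a \<in> K"
        using \<open>a \<in> K\<close> fdpm_W_uminus by (auto simp: K_def)
      have "k \<in> a +o K" if "k \<in> K" for k
      proof -
        have "- a + k \<in> K"
          using set_plus_intro[OF \<open>- a \<in> K\<close> that] K_K by simp
        then have "a + (- a + k) \<in> a +o K"
          by (rule set_plus_intro2)
        then show ?thesis
          by simp
      qed
      then show "a +o K = K"
        using set_plus_mono3[OF \<open>a \<in> K\<close>, of K] K_K by auto
    qed
    also have "\<dots> \<longleftrightarrow> a \<in> fdpm_T r"
      using a by (simp add: K_def)
    finally show "\<psi> a = 0 \<longleftrightarrow> a \<in> fdpm_T r" .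
  next
    fix x and a :: "nat \<Rightarrow> 'k" assume x: "x \<in> N" and a: "a \<in> fdpm_W r"
    have K_inv: "k (inv' (\<phi> x) i) = k i" if "k \<in> K" for k i
    proof -
      have iff: "inv' (\<phi> x) i \<in> {1..r} \<longleftrightarrow> i \<in> {1..r}"
        using permutes_inv[OF perm[OF x]] by (rule permutes_in_image)
      obtain c where k: "k = (\<lambda>i. if i \<in> {1..r} then c else 0)"
        using \<open>k \<in> K\<close> unfolding K_def fdpm_T_def by blast
      show ?thesis
        by (simp only: k iff)
    qed
    have "fdpm_act (\<phi> x) (a +o K) = (\<lambda>k. (a \<circ> inv' (\<phi> x)) + k) ` K"
      unfolding fdpm_act_def elt_set_plus_def
      using K_inv by (force simp: image_def fun_eq_iff)
    also have "\<dots> = (a \<circ> inv' (\<phi> x)) +o K"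
      by (auto simp: elt_set_plus_def)
    finally have "f (x (\<psi> a)) = (a \<circ> inv' (\<phi> x)) +o K"
      by (simp add: f_act x f_\<psi> a)
    then show "x (\<psi> a) = \<psi> (a \<circ> inv' (\<phi> x))"
      by (rule \<psi>_eq[symmetric])
  next
    show "\<phi> ` N = carrier (alt_group r)"
      using \<phi> by (simp add: epi_def perm_group_simps)
  next
    fix x y assume "x \<in> N" "y \<in> N"
    then show "\<phi> (x \<circ> y) = \<phi> x \<circ> \<phi> y" "x \<circ> y \<in> N"
      using \<phi> comp[of x y] hom_mult[of \<phi> "perm_group N" "alt_group r" x y]
      by (simp_all add: epi_def perm_group_simps(1) alt_group_mult)
  next
    show "id \<in> N"
      using subgroup.one_closed[OF N] by (simp add: perm_group_simps)
  qed
  then show thesis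
    by (rule that)
qed

section \<open>Orbital diameter\<close>

lemma orbital_nondiagonal:
  fixes v :: "'v::zero" and G :: "('v \<Rightarrow> 'v) set"
  assumes "id \<in> G" "v \<noteq> 0"
  shows "{(g 0, g v) | g. g \<in> G} \<in> nondiagonal_orbitals G"
proof -
  let ?E = "{(g 0, g v) | g. g \<in> G}"
  have "(0, v) \<in> ?E"
    using assms(1) by (intro CollectI exI[of _ id]) simp
  then have "?E \<noteq> Id"
    using assms(2) by (metis pair_in_Id_conv)
  moreover have "?E = orbit (perm_group G) (\<lambda>g (x, y). (g x, g y)) (0, v)"
    by (simp add: orbit_def perm_group_simps(1))
  ultimately show ?thesis
    by (auto simp: nondiagonal_orbitals_def orbits_def)
qed

text \<open>If there is no walk at all, the second hypothesis is vacuous and the distance is infinite.\<close>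

lemma orbdiam_ge:
  assumes "E \<in> nondiagonal_orbitals G"
    and "\<And>m. (x, y) \<in> (E \<union> E\<inverse>) ^^ m \<Longrightarrow> B \<le> real m"
  shows "ereal B \<le> ereal_of_enat (orbdiam G)"
proof -
  have "enat (nat \<lceil>B\<rceil>) \<le> graph_dist E x y"
    unfolding graph_dist_def
  proof (rule INF_greatest)
    fix m assume "m \<in> {m. (x, y) \<in> (E \<union> E\<inverse>) ^^ m}"
    then have "B \<le> real m"
      using assms(2) by blast
    then show "enat (nat \<lceil>B\<rceil>) \<le> enat m"
      by (simp add: ceiling_le_iff)
  qed
  also have "\<dots> \<le> graph_diam E"
    unfolding graph_diam_def by (rule SUP_upper2[of "(x, y)"]) auto
  also have "\<dots> \<le> orbdiam G"
    unfolding orbdiam_def using assms(1) by (rule SUP_upper)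
  finally have "ereal_of_enat (enat (nat \<lceil>B\<rceil>)) \<le> ereal_of_enat (orbdiam G)"
    by (simp only: ereal_of_enat_le_iff)
  moreover have "ereal B \<le> ereal_of_enat (enat (nat \<lceil>B\<rceil>))"
    using real_nat_ceiling_ge[of B] by simp
  ultimately show ?thesis
    by (rule order_trans[rotated])
qed

lemma one_le_orbdiam:
  fixes v :: "'v::zero" and G :: "('v \<Rightarrow> 'v) set"
  assumes "id \<in> G" "v \<noteq> 0"
  shows "ereal 1 \<le> ereal_of_enat (orbdiam G)"
proof (rule orbdiam_ge[OF orbital_nondiagonal[OF assms]])
  fix m assume walk: "(0, v) \<in> ({(g 0, g v) | g. g \<in> G} \<union> {(g 0, g v) | g. g \<in> G}\<inverse>) ^^ m"
  have "m \<noteq> 0"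
    using walk assms(2) by (cases m) auto
  then show "1 \<le> real m"
    by simp
qed

theorem proposition1p9:
  fixes G :: "('k::finite_field ^ 'n \<Rightarrow> 'k ^ 'n) set" and r p :: nat
  assumes "p = CHAR('k)"
    and "primitive_affine G"
    and "perm_group (G0_infty G) Mod group_center (perm_group (G0_infty G)) \<cong> alt_group r"
    and "simple_group (alt_group r)" and "\<not> comm_group (alt_group r)"
    and "absolutely_irreducible (G0_infty G)"
    and "\<not> (\<exists>F. subfield F (ring_of_type_algebra :: 'k ring) \<and> F \<noteq> UNIV \<and>
                realised_over (G0_infty G) F)"
    and "is_fdpm r (G0_infty G)"
  shows "(\<not> p dvd r \<longrightarrow> ereal_of_enat (orbdiam G) \<ge> ereal ((real r - 1) / 2)) \<and>
         (p dvd r \<longrightarrow> ereal_of_enat (orbdiam G) \<ge> ereal ((real r - 2) / 4))"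
proof -
  have G: "subgroup G (BijGroup UNIV)"
    using assms(2) by (simp add: primitive_affine_def)
  have id_G: "id \<in> G"
    using subgroup.one_closed[OF G] by (simp add: perm_group_simps)
  obtain \<phi> and \<psi> :: "(nat \<Rightarrow> 'k) \<Rightarrow> 'k ^ 'n" where "fdpm_quotient r (G0_infty G) \<phi> \<psi>"
    using is_fdpm_imp_quotient[OF assms(8) G0_infty_properties(1)[OF G]] .
  then interpret fdpm_quotient r "G0_infty G" \<phi> \<psi> .
  show ?thesis
    \<comment> \<open>in the first case both bounds are at most 1\<close>
  proof (cases "if p dvd r then r \<le> 6 else r \<le> 3")
    case True
    have "ereal 1 \<le> ereal_of_enat (orbdiam G)"
      using one_le_orbdiam[OF id_G, of "\<chi> i. 1"] by (simp add: vec_eq_iff)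
    moreover have "ereal ((real r - 1) / 2) \<le> ereal 1" if "\<not> p dvd r"
      using True that by simp
    moreover have "ereal ((real r - 2) / 4) \<le> ereal 1" if "p dvd r"
      using True that by simp
    ultimately show ?thesis
      by (meson order_trans)
  next
    case False
    then have r: "4 \<le> r"
      by (auto split: if_splits)
    \<comment> \<open>either there is no nonzero constant vector of sum 0, or its weight is \<open>r \<ge> 7\<close>\<close>
    have small: "a = 0" if "a \<in> fdpm_W r" "a \<in> fdpm_T r" "card (supp a) \<le> 6" for a :: "nat \<Rightarrow> 'k"
      using fdpm_W_inter_T_trivial[OF _ that(1,2)] card_supp_fdpm_T[OF that(2)] that(3) False assms(1)
      by (auto split: if_splits)
    let ?v = "\<psi> (root_vec 2 1)"
    let ?E = "{(h 0, h ?v) | h. h \<in> G}"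
    have root_W: "root_vec 2 1 \<in> fdpm_W r"
      using r by (intro root_vec_in_fdpm_W) auto
    have "supp (root_vec 2 1 :: nat \<Rightarrow> 'k) = {1, 2}"
      by (auto simp: supp_def root_vec_def)
    then have "root_vec 2 1 \<noteq> (0 :: nat \<Rightarrow> 'k)" "card (supp (root_vec 2 1 :: nat \<Rightarrow> 'k)) \<le> 6"
      by (auto simp: supp_zero)
    then have v: "?v \<noteq> 0"
      using small[OF root_W] proj_eq_0_iff[OF root_W] by blast
    have edge: "\<exists>u \<in> fdpm_W r. card (supp u) \<le> 2 \<and> y - x = \<psi> u" if "(x, y) \<in> ?E" for x y
    proof -
      obtain h where h: "h \<in> G" "x = h 0" "y = h ?v"
        using \<open>(x, y) \<in> ?E\<close> by blast
      then obtain g where g: "g \<in> zero_stabilizer G" "\<And>v. h v = g v + h 0"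
        using primitive_affine_elements(3)[OF assms(2)] by blast
      have "\<exists>u \<in> fdpm_W r. card (supp u) \<le> 2 \<and> g ?v = \<psi> u"
        using small r primitive_affine_elements(1,2)[OF assms(2) g(1)] G0_infty_properties(2)[OF G g(1)]
        by (rule normalizer_root_weight)
      then show ?thesis
        using h(2,3) g(2)[of ?v] by simp
    qed
    have walk: "\<exists>u \<in> fdpm_W r. (u :: nat \<Rightarrow> 'k) - step_vec h \<in> fdpm_T r \<and> card (supp u) \<le> 2 * m"
      if h: "2 * h \<le> r" and w: "(0, \<psi> (step_vec h)) \<in> (?E \<union> ?E\<inverse>) ^^ m" for h m
    proof -
      obtain u where u: "u \<in> fdpm_W r" "card (supp u) \<le> 2 * m" "\<psi> (step_vec h) = \<psi> u"
        using walk_weight[OF edge w] by blast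
      then have "u - step_vec h \<in> fdpm_T r"
        using proj_eq_iff[OF u(1) step_vec_in_fdpm_W[OF h]] by simp
      then show ?thesis
        using u by blast
    qed
    have "ereal ((real r - 1) / 2) \<le> ereal_of_enat (orbdiam G)" if p: "\<not> p dvd r"
    proof (rule orbdiam_ge[OF orbital_nondiagonal[OF id_G v]])
      \<comment> \<open>cosets are single vectors here, so the support is taken as large as possible\<close>
      let ?h = "r div 2"
      fix m assume "(0, \<psi> (step_vec ?h)) \<in> (?E \<union> ?E\<inverse>) ^^ m"
      then obtain u :: "nat \<Rightarrow> 'k"
        where u: "u \<in> fdpm_W r" "u - step_vec ?h \<in> fdpm_T r" "card (supp u) \<le> 2 * m"
        using walk[of ?h m] by auto
      have "u - step_vec ?h \<in> fdpm_W r"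
        using u(1) by (intro fdpm_W_diff step_vec_in_fdpm_W) auto
      then have "u - step_vec ?h = 0"
        using p u(2) unfolding assms(1) by (intro fdpm_W_inter_T_trivial)
      then have "card (supp u) = 2 * ?h"
        by (simp add: supp_step_vec)
      then have "r \<le> 2 * m + 1"
        using u(3) by linarith
      then have "real r \<le> real (2 * m + 1)"
        by (rule of_nat_mono)
      then show "(real r - 1) / 2 \<le> real m"
        by simp
    qed
    moreover have "ereal ((real r - 2) / 4) \<le> ereal_of_enat (orbdiam G)"
    proof (rule orbdiam_ge[OF orbital_nondiagonal[OF id_G v]])
      \<comment> \<open>\<open>2 h\<close> and \<open>r - 2 h\<close> both have to be at least \<open>(r - 2) / 2\<close>; rounding \<open>r / 4\<close> up only if
        \<open>r mod 4 = 3\<close> achieves this for every \<open>r\<close>\<close>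
      let ?h = "(r + 1) div 4"
      fix m assume "(0, \<psi> (step_vec ?h)) \<in> (?E \<union> ?E\<inverse>) ^^ m"
      moreover have h: "2 * ?h \<le> r"
        using r by linarith
      ultimately obtain u :: "nat \<Rightarrow> 'k"
        where u: "u \<in> fdpm_W r" "u - step_vec ?h \<in> fdpm_T r" "card (supp u) \<le> 2 * m"
        using walk[of ?h m] by auto
      from h have "2 * ?h \<le> card (supp u) \<or> r - 2 * ?h \<le> card (supp u)"
        using step_vec_coset_weight u(1,2) by blast
      then have "r \<le> 4 * m + 2"
        using u(3) by linarith
      then have "real r \<le> real (4 * m + 2)"
        by (rule of_nat_mono)
      then show "(real r - 2) / 4 \<le> real m"
        by simp
    qed
    ultimately show ?thesis
      by blast
  qed
qed

end
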